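(* Let $n\ge 2$. There exists a constant $C(n)>0$, depending only on the dimension $n$, such that for every $0<\delta<1$, every weight $w\in A_1$ on $\mathbb{R}^n$, every cube $Q$ in $\mathbb{R}^n$ and every $u\in C^1(Q)$, \[ \ell(Q)^{\delta}\int_Q\int_Q \frac{|u(x)-u(y)|}{|x-y|^{n+\delta}}\,dy\,w(x)\,dx\le C(n)\,\frac{[w]_{A_1}}{(1-\delta)^2}\,\ell(Q)\int_Q|\nabla u(x)|\,w(x)\,dx. \]
   Context: A cube $Q$ in $\mathbb{R}^n$ is a cartesian product of $n$ intervals of the same side length, denoted $\ell(Q)$. A weight is a function $w\in L^1_{\mathrm{loc}}(\mathbb{R}^n)$ with $w(x)>0$ for almost every $x$. A weight $w$ belongs to $A_1$ if there is a constant $C>0$ such that $\frac{1}{|Q|}\int_Q w(x)\,dx\le C\,\mathrm{ess\,inf}_{x\in Q}w(x)$ for every cube $Q$ in $\mathbb{R}^n$; the $A_1$ constant $[w]_{A_1}$ is the smallest such $C$. *)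

theory Defs
  imports "HOL-Analysis.Analysis" "HOL-Probability.Essential_Supremum"
begin

text \<open>
  A bounded interval of length \<open>l > 0\<close> is a set lying between \<open>{b<..<b + l}\<close> and
  \<open>{b..b + l}\<close>. The faces of a cube may thus be included or not.
\<close>

definition cube :: "real \<Rightarrow> (real ^ 'n) set \<Rightarrow> bool" where
  "cube l Q \<longleftrightarrow> 0 < l \<and>
    (\<exists>b I. (\<forall>i. {b i<..<b i + l} \<subseteq> I i \<and> I i \<subseteq> {b i..b i + l}) \<and> Q = {x. \<forall>i. x $ i \<in> I i})"

definition locally_integrable :: "(real ^ 'n \<Rightarrow> real) \<Rightarrow> bool" where
  "locally_integrable w \<longleftrightarrow> (\<forall>K. compact K \<longrightarrow> set_integrable lebesgue K w)"

definition weight :: "(real ^ 'n \<Rightarrow> real) \<Rightarrow> bool" where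
  "weight w \<longleftrightarrow> locally_integrable w \<and> (AE x in lebesgue. 0 < w x)"

definition essinf :: "'a measure \<Rightarrow> ('a \<Rightarrow> real) \<Rightarrow> ereal" where
  "essinf M f = - esssup M (\<lambda>x. - ereal (f x))"

definition A1_bound :: "(real ^ 'n \<Rightarrow> real) \<Rightarrow> real \<Rightarrow> bool" where
  "A1_bound w C \<longleftrightarrow> 0 < C \<and>
    (\<forall>l Q. cube l Q \<longrightarrow>
      ereal ((LINT x:Q|lebesgue. w x) / measure lebesgue Q) \<le> ereal C * essinf (lebesgue_on Q) w)"

definition A1_weight :: "(real ^ 'n \<Rightarrow> real) \<Rightarrow> bool" where
  "A1_weight w \<longleftrightarrow> weight w \<and> (\<exists>C. A1_bound w C)"

text \<open>For an \<open>A\<^sub>1\<close> weight the infimum is attained, so it is the smallest admissible constant.\<close>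

definition A1_const :: "(real ^ 'n \<Rightarrow> real) \<Rightarrow> real" where
  "A1_const w = Inf {C. A1_bound w C}"

text \<open>
  Derivatives are taken within \<open>S\<close>, so on a cube containing boundary points they are one-sided
  there. The Frechet derivative within a cube is unique, and its values on the unit vectors are
  the partial derivatives.
\<close>

definition grad :: "(real ^ 'n) set \<Rightarrow> (real ^ 'n \<Rightarrow> real) \<Rightarrow> real ^ 'n \<Rightarrow> real ^ 'n" where
  "grad S u x = (\<chi> i. frechet_derivative u (at x within S) (axis i 1))"

definition C1_on :: "(real ^ 'n) set \<Rightarrow> (real ^ 'n \<Rightarrow> real) \<Rightarrow> bool" where
  "C1_on S u \<longleftrightarrow> u differentiable_on S \<and> continuous_on S (grad S u)"

end

theory Submission
  imports Defs
begin

text \<open>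
  Integrating the gradient along the segment from \<open>x\<close> to \<open>y\<close> and substituting
  \<open>z = x + t (y - x)\<close> for fixed \<open>t\<close> produces the Jacobian factor \<open>t\<close> to the power \<open>\<delta> - 1\<close>, whose integral
  over \<open>[0, 1]\<close> is \<open>1 / \<delta>\<close>. This bounds the inner integral by \<open>1 / \<delta>\<close> times the Riesz potential of order
  \<open>1 - \<delta>\<close> of \<open>|\<nabla>u|\<close> on \<open>Q\<close>. By Tonelli the potential can be moved to the weight, and cutting it
  into dyadic shells around \<open>z\<close> the \<open>A\<^sub>1\<close> condition bounds it by a geometric series, of order
  \<open>w z / (1 - \<delta>)\<close>. To keep \<open>1 / \<delta>\<close> bounded, \<open>\<delta>\<close> is first replaced by \<open>(1 + \<delta>) / 2\<close>, which costs only a dimensional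
  constant because \<open>|x - y| \<le> n l\<close> on \<open>Q\<close>.
\<close>

section \<open>Measurability, convexity and size of cubes\<close>

lemma sets_borel_between_intervals:
  fixes b l :: real
  assumes "{b<..<b + l} \<subseteq> J" "J \<subseteq> {b..b + l}"
  shows "J \<in> sets borel"
proof -
  have "J = {b<..<b + l} \<union> (J \<inter> {b, b + l})"
    using assms by force
  moreover have "J \<inter> {b, b + l} \<in> sets borel"
    by (intro borel_closed finite_imp_closed) auto
  ultimately show ?thesis
    by (metis borel_open open_greaterThanLessThan sets.Un)
qed

lemma cube_sets_borel:
  fixes Q :: "(real ^ 'n) set"
  assumes "cube l Q"
  shows "Q \<in> sets borel"
proof -
  obtain b I where I: "\<And>i. {b i<..<b i + l} \<subseteq> I i \<and> I i \<subseteq> {b i..b i + l}"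
    and Q: "Q = {x. \<forall>i. x $ i \<in> I i}"
    using assms by (auto simp: cube_def)
  have "Q = (\<Inter>i. (\<lambda>x. x $ i) -` I i \<inter> space borel)"
    unfolding Q by auto
  also have "\<dots> \<in> sets borel"
    using I by (intro sets.countable_INT'' measurable_sets[of _ borel borel]
        sets_borel_between_intervals[of "b _" l]) auto
  finally show ?thesis .
qed

lemma cube_convex:
  fixes Q :: "(real ^ 'n) set"
  assumes "cube l Q"
  shows "convex Q"
proof -
  obtain b I where I: "\<And>i. {b i<..<b i + l} \<subseteq> I i \<and> I i \<subseteq> {b i..b i + l}"
    and Q: "Q = {x. \<forall>i. x $ i \<in> I i}"
    using assms by (auto simp: cube_def)
  have "is_interval (I i)" for i
    unfolding is_interval_1
  proof (intro ballI allI impI)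
    fix x y z assume "x \<in> I i" "y \<in> I i" "x \<le> z \<and> z \<le> y"
    \<comment> \<open>A point \<open>z\<close> other than \<open>x\<close> and \<open>y\<close> lies
      strictly between them, hence in the open interval contained in \<open>I i\<close>; only the
      endpoints depend on which faces belong to the cube.\<close>
    then show "z \<in> I i"
      using I[of i] by (cases "z = x \<or> z = y") force+
  qed
  then have "convex (I i)" for i
    by (simp add: is_interval_convex)
  then show ?thesis
    unfolding Q by (auto simp: convex_def)
qed

lemma cube_component_diff_le:
  fixes Q :: "(real ^ 'n) set"
  assumes "cube l Q" "x \<in> Q" "y \<in> Q"
  shows "\<bar>x $ i - y $ i\<bar> \<le> l"
proof -
  obtain b I where I: "\<And>i. {b i<..<b i + l} \<subseteq> I i \<and> I i \<subseteq> {b i..b i + l}"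
    and Q: "Q = {x. \<forall>i. x $ i \<in> I i}"
    using assms by (auto simp: cube_def)
  have "x $ i \<in> {b i..b i + l}" "y $ i \<in> {b i..b i + l}"
    using assms(2,3) I[of i] unfolding Q by auto
  then show ?thesis by auto
qed

section \<open>Gradients along segments and dilations of integrals\<close>

lemma C1_on_norm_grad_measurable:
  fixes u :: "real ^ 'n \<Rightarrow> real"
  assumes "S \<in> sets borel" "C1_on S u"
  shows "(\<lambda>z. ennreal (norm (grad S u z)) * indicator S z) \<in> borel_measurable borel"
proof -
  have "(\<lambda>z. indicator S z *\<^sub>R grad S u z) \<in> borel_measurable borel"
    using assms by (intro borel_measurable_continuous_on_indicator) (simp_all add: C1_on_def)
  then have "(\<lambda>z. ennreal (norm (indicator S z *\<^sub>R grad S u z))) \<in> borel_measurable borel"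
    by measurable
  also have "(\<lambda>z. ennreal (norm (indicator S z *\<^sub>R grad S u z))) =
      (\<lambda>z. ennreal (norm (grad S u z)) * indicator S z)"
    by (auto simp: indicator_def)
  finally show ?thesis .
qed

text \<open>The fundamental theorem of calculus is applied to \<open>u\<close> along the segment,
  which stays in \<open>S\<close> by convexity; Cauchy-Schwarz then splits off the length of the
  segment.\<close>

lemma C1_on_diff_le_segment_integral:
  fixes u :: "real ^ 'n \<Rightarrow> real"
  assumes S: "convex S" and u: "C1_on S u" and x: "x \<in> S" and y: "y \<in> S"
  shows "ennreal \<bar>u x - u y\<bar> \<le>
    ennreal (norm (x - y)) * (\<integral>\<^sup>+t\<in>{0..1}. ennreal (norm (grad S u (x + t *\<^sub>R (y - x)))) \<partial>lborel)"
proof -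
  define \<gamma> where "\<gamma> t = x + t *\<^sub>R (y - x)" for t
  have \<gamma>S: "\<gamma> ` {0..1} \<subseteq> S"
  proof -
    have "\<gamma> t = (1 - t) *\<^sub>R x + t *\<^sub>R y" for t
      by (simp add: \<gamma>_def algebra_simps)
    then show ?thesis
      using S x y by (auto simp: convex_alt)
  qed
  have cont: "continuous_on {0..1} (\<lambda>t. grad S u (\<gamma> t))"
    using u \<gamma>S unfolding C1_on_def
    by (intro continuous_on_compose2[of S "grad S u" _ \<gamma>]) (auto simp: \<gamma>_def intro!: continuous_intros)
  have der: "((u \<circ> \<gamma>) has_vector_derivative grad S u (\<gamma> t) \<bullet> (y - x)) (at t within {0..1})"
    if t: "t \<in> {0..1}" for t
  proof -
    define D where "D = frechet_derivative u (at (\<gamma> t) within S)"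
    have "(u has_derivative D) (at (\<gamma> t) within S)"
      using u t \<gamma>S unfolding C1_on_def differentiable_on_def D_def
      by (metis frechet_derivative_works image_subset_iff)
    \<comment> \<open>Shrinking the set from \<open>S\<close> to the segment gives the chain rule
      also where the segment meets the boundary of \<open>S\<close> and the derivative is
      one-sided.\<close>
    then have D: "(u has_derivative D) (at (\<gamma> t) within \<gamma> ` {0..1})"
      using \<gamma>S has_derivative_subset by blast
    have "(\<gamma> has_derivative (\<lambda>s. s *\<^sub>R (y - x))) (at t within {0..1})"
      unfolding \<gamma>_def by (auto intro!: derivative_eq_intros)
    from diff_chain_within[OF this D]
    have "(u \<circ> \<gamma> has_derivative (\<lambda>s. D (s *\<^sub>R (y - x)))) (at t within {0..1})"
      by (simp add: o_def)
    moreover have "D v = grad S u (\<gamma> t) \<bullet> v" for v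
    proof -
      have lin: "linear D"
        using D has_derivative_linear by blast
      have "D v = D (\<Sum>i\<in>UNIV. v $ i *\<^sub>R axis i 1)"
        by (simp add: basis_expansion scalar_mult_eq_scaleR[symmetric])
      also have "\<dots> = (\<Sum>i\<in>UNIV. v $ i * D (axis i 1))"
        by (simp add: linear_sum[OF lin] linear_cmul[OF lin])
      also have "\<dots> = grad S u (\<gamma> t) \<bullet> v"
        by (simp add: grad_def inner_vec_def D_def mult.commute)
      finally show ?thesis .
    qed
    ultimately show ?thesis
      by (simp add: has_vector_derivative_def)
  qed
  have I: "((\<lambda>t. grad S u (\<gamma> t) \<bullet> (y - x)) has_integral (u y - u x)) {0..1}"
    using fundamental_theorem_of_calculus[of 0 1 "u \<circ> \<gamma>", OF _ der] by (simp add: \<gamma>_def)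
  have int: "(\<lambda>t. norm (grad S u (\<gamma> t))) integrable_on {0..1}"
    using cont by (intro integrable_continuous_interval continuous_intros)
  have "\<bar>u x - u y\<bar> = norm (integral {0..1} (\<lambda>t. grad S u (\<gamma> t) \<bullet> (y - x)))"
    using integral_unique[OF I] by simp
  also have "\<dots> \<le> integral {0..1} (\<lambda>t. norm (x - y) * norm (grad S u (\<gamma> t)))"
  proof (rule integral_norm_bound_integral)
    show "(\<lambda>t. grad S u (\<gamma> t) \<bullet> (y - x)) integrable_on {0..1}"
      using I by blast
    show "(\<lambda>t. norm (x - y) * norm (grad S u (\<gamma> t))) integrable_on {0..1}"
      using integrable_on_cmult_left[OF int] by simp
  qed (metis Cauchy_Schwarz_ineq2 mult.commute norm_minus_commute real_norm_def)
  also have "\<dots> = norm (x - y) * integral {0..1} (\<lambda>t. norm (grad S u (\<gamma> t)))"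
    by simp
  finally have "ennreal \<bar>u x - u y\<bar> \<le>
      ennreal (norm (x - y)) * ennreal (integral {0..1} (\<lambda>t. norm (grad S u (\<gamma> t))))"
    by (metis ennreal_leI ennreal_mult' norm_ge_zero)
  also have "ennreal (integral {0..1} (\<lambda>t. norm (grad S u (\<gamma> t)))) =
      (\<integral>\<^sup>+t\<in>{0..1}. ennreal (norm (grad S u (\<gamma> t))) \<partial>lborel)"
    using int by (intro nn_integral_has_integral_lebesgue'[symmetric]) auto
  finally show ?thesis
    by (simp add: \<gamma>_def)
qed

text \<open>The substitution is y = \<open>T z\<close> = x + (z - x) / t. Its Jacobian contributes t
  to the power \<open>- DIM('a)\<close>, and the homogeneity of the kernel contributes t to the
  power p.\<close>

lemma nn_integral_lborel_dilation:
  fixes g :: "'a::euclidean_space \<Rightarrow> ennreal"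
  assumes g [measurable]: "g \<in> borel_measurable borel" and t: "0 < t"
  shows "(\<integral>\<^sup>+y. g (x + t *\<^sub>R (y - x)) * ennreal (norm (x - y) powr - p) \<partial>lborel) =
    ennreal (t powr (p - DIM('a))) * (\<integral>\<^sup>+z. g z * ennreal (norm (x - z) powr - p) \<partial>lborel)"
proof -
  define c where "c = 1 / t"
  have c: "c > 0" "t * c = 1" using t by (auto simp: c_def)
  define T where "T z = (x - c *\<^sub>R x) + c *\<^sub>R z" for z
  have [measurable]: "T \<in> borel_measurable borel"
    unfolding T_def by measurable
  have *: "x + t *\<^sub>R (T z - x) = z" for z
    using c by (simp add: T_def scaleR_right_diff_distrib scaleR_right_distrib)
  have **: "norm (x - T z) powr - p = c powr - p * norm (x - z) powr - p" for z
  proof -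
    have "x - T z = c *\<^sub>R (x - z)" by (simp add: T_def algebra_simps)
    then show ?thesis using c by (simp add: powr_mult)
  qed
  have cc: "\<bar>c\<bar> ^ DIM('a) * c powr - p = t powr (p - DIM('a))"
    using t by (simp add: c_def powr_diff powr_realpow powr_minus powr_divide field_simps power_one_over)
  have "lborel = density (distr lborel borel T) (\<lambda>_. ennreal (\<bar>c\<bar> ^ DIM('a)))"
    using lborel_affine[of c "x - c *\<^sub>R x"] c unfolding T_def by simp
  then have "(\<integral>\<^sup>+y. g (x + t *\<^sub>R (y - x)) * ennreal (norm (x - y) powr - p) \<partial>lborel) =
      (\<integral>\<^sup>+y. g (x + t *\<^sub>R (y - x)) * ennreal (norm (x - y) powr - p)
        \<partial>density (distr lborel borel T) (\<lambda>_. ennreal (\<bar>c\<bar> ^ DIM('a))))"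
    by (rule arg_cong)
  also have "\<dots> = (\<integral>\<^sup>+z. ennreal (\<bar>c\<bar> ^ DIM('a)) * (g z * ennreal (c powr - p * norm (x - z) powr - p)) \<partial>lborel)"
    by (simp add: nn_integral_density nn_integral_distr * **)
  also have "\<dots> = (\<integral>\<^sup>+z. ennreal (t powr (p - DIM('a))) * (g z * ennreal (norm (x - z) powr - p)) \<partial>lborel)"
    by (simp add: cc[symmetric] ennreal_mult' mult_ac)
  finally show ?thesis
    by (simp add: nn_integral_cmult)
qed

lemma nn_integral_powr_unit_interval:
  fixes a :: real
  assumes "-1 < a"
  shows "(\<integral>\<^sup>+t\<in>{0..1}. ennreal (t powr a) \<partial>lborel) = ennreal (1 / (a + 1))"
  using nn_integral_has_integral_lebesgue'[OF _ has_integral_powr_from_0[OF assms, of 1]] by simp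

section \<open>Integrals of \<open>A\<^sub>1\<close> weights over cubes\<close>

lemma locally_integrable_measurable:
  fixes w :: "real ^ 'n \<Rightarrow> real"
  assumes "locally_integrable w"
  shows "w \<in> borel_measurable lebesgue"
proof (rule borel_measurable_LIMSEQ_real)
  show "(\<lambda>x. indicator (cball 0 (real k)) x *\<^sub>R w x) \<in> borel_measurable lebesgue" for k
    using assms unfolding locally_integrable_def set_integrable_def
    by (meson borel_measurable_integrable compact_cball)
  show "(\<lambda>k. indicator (cball 0 (real k)) x *\<^sub>R w x) \<longlonglongrightarrow> w x" for x
  proof (rule tendsto_eventually)
    obtain k0 where "norm x \<le> real k0"
      using real_arch_simple by blast
    then show "\<forall>\<^sub>F k in sequentially. indicator (cball 0 (real k)) x *\<^sub>R w x = w x"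
      by (auto simp: eventually_sequentially intro!: exI[of _ k0])
  qed
qed

lemma A1_const_nonneg:
  assumes "A1_weight w"
  shows "0 \<le> A1_const w"
  using assms unfolding A1_const_def A1_weight_def
  by (intro cInf_greatest) (auto simp: A1_bound_def)

text \<open>Almost every point of \<open>R\<close> carries a weight at least the essential infimum,
  so the average over \<open>R\<close> is at most \<open>C * w z\<close> for each admissible
  \<open>C\<close>. The exceptional null set depends on \<open>R\<close>.\<close>

lemma A1_closed_cube_integral_le:
  fixes w :: "real ^ 'n \<Rightarrow> real" and a :: "'n \<Rightarrow> real"
  assumes w: "A1_weight w" and r: "0 < r"
  defines "R \<equiv> {x. \<forall>i. a i \<le> x $ i \<and> x $ i \<le> a i + r}"
  shows "AE z in lebesgue. z \<in> R \<longrightarrow>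
    (\<integral>\<^sup>+x\<in>R. ennreal (w x) \<partial>lebesgue) \<le> ennreal (A1_const w * r ^ CARD('n) * w z)"
proof -
  have cube: "cube r R"
    unfolding cube_def R_def using r
    by (auto intro!: exI[of _ a] exI[of _ "\<lambda>i. {a i..a i + r}"])
  have R: "R = cbox (\<chi> i. a i) (\<chi> i. a i + r)"
    by (auto simp: R_def mem_box_cart)
  have meas: "measure lebesgue R = r ^ CARD('n)"
    using r by (simp add: R content_cbox_cart interval_ne_empty_cart)
  have pos: "AE x in lebesgue. 0 < w x"
    using w by (auto simp: A1_weight_def weight_def)
  have int: "set_integrable lebesgue R w"
    using w by (auto simp: A1_weight_def weight_def locally_integrable_def R)
  define m where "m = (LINT x:R|lebesgue. w x) / r ^ CARD('n)"
  have "(\<integral>\<^sup>+x\<in>R. ennreal (w x) \<partial>lebesgue) = (\<integral>\<^sup>+x. ennreal (indicator R x *\<^sub>R w x) \<partial>lebesgue)"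
    by (intro nn_integral_cong) (auto simp: indicator_def)
  also have "\<dots> = ennreal (LINT x:R|lebesgue. w x)"
    unfolding set_lebesgue_integral_def
    using int pos by (intro nn_integral_eq_integral) (auto simp: set_integrable_def elim: eventually_mono)
  also have "\<dots> = ennreal (m * r ^ CARD('n))"
    using r by (simp add: m_def)
  finally have eq: "(\<integral>\<^sup>+x\<in>R. ennreal (w x) \<partial>lebesgue) = ennreal (m * r ^ CARD('n))" .
  have "AE z in lebesgue_on R. - ereal (w z) \<le> esssup (lebesgue_on R) (\<lambda>x. - ereal (w x))"
    by (rule esssup_AE)
  then have "AE z in lebesgue. z \<in> R \<longrightarrow> - ereal (w z) \<le> esssup (lebesgue_on R) (\<lambda>x. - ereal (w x))"
    by (subst (asm) AE_restrict_space_iff) (auto simp: R)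
  then show ?thesis
    using pos
  proof eventually_elim
    case (elim z)
    show ?case
    proof
      assume "z \<in> R"
      with elim have ess: "essinf (lebesgue_on R) w \<le> ereal (w z)"
        unfolding essinf_def using ereal_uminus_le_reorder by blast
      \<comment> \<open>Dividing by \<open>w z > 0\<close> turns the estimate for each
        \<open>C\<close> into a lower bound for all admissible constants, which passes to their
        infimum.\<close>
      have "m / w z \<le> A1_const w"
        unfolding A1_const_def
      proof (rule cInf_greatest)
        show "{C. A1_bound w C} \<noteq> {}"
          using w by (auto simp: A1_weight_def)
        fix C assume "C \<in> {C. A1_bound w C}"
        then have C: "0 < C" "ereal m \<le> ereal C * essinf (lebesgue_on R) w"
          using cube unfolding A1_bound_def m_def meas[symmetric] by blast+
        note C(2)
        also have "ereal C * essinf (lebesgue_on R) w \<le> ereal C * ereal (w z)"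
          using C(1) by (intro ereal_mult_left_mono ess) simp
        finally show "m / w z \<le> C"
          using elim(2) by (simp add: field_simps)
      qed
      then have "m \<le> A1_const w * w z"
        using elim(2) by (simp add: field_simps)
      then have "m * r ^ CARD('n) \<le> A1_const w * r ^ CARD('n) * w z"
        using r by (simp add: mult_ac)
      then show "(\<integral>\<^sup>+x\<in>R. ennreal (w x) \<partial>lebesgue) \<le> ennreal (A1_const w * r ^ CARD('n) * w z)"
        unfolding eq by (rule ennreal_leI)
    qed
  qed
qed

text \<open>
  The cubes centred at \<open>z\<close> form an uncountable family, so each is enlarged to a cube of side
  \<open>3 * r k\<close> with a corner on a lattice of mesh \<open>r k\<close>. There are countably many of these, which gives one null
  set for all scales.
\<close>

lemma A1_centred_cubes_integral_le:
  fixes w :: "real ^ 'n \<Rightarrow> real"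
  assumes w: "A1_weight w" and r: "\<And>k::nat. 0 < r k"
  shows "AE z in lebesgue. \<forall>k.
    (\<integral>\<^sup>+x\<in>{x. \<forall>i. \<bar>x $ i - z $ i\<bar> \<le> r k}. ennreal (w x) \<partial>lebesgue)
      \<le> ennreal (A1_const w * (3 * r k) ^ CARD('n) * w z)"
proof -
  define R where "R k m = {x :: real ^ 'n. \<forall>i. r k * real_of_int (m i) \<le> x $ i \<and>
    x $ i \<le> r k * real_of_int (m i) + 3 * r k}" for k and m :: "'n \<Rightarrow> int"
  have "AE z in lebesgue. \<forall>k m. z \<in> R k m \<longrightarrow> (\<integral>\<^sup>+x\<in>R k m. ennreal (w x) \<partial>lebesgue)
      \<le> ennreal (A1_const w * (3 * r k) ^ CARD('n) * w z)"
    unfolding AE_all_countable R_def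
    using A1_closed_cube_integral_le[OF w, of "3 * r _"] r by simp
  then show ?thesis
  proof eventually_elim
    case (elim z)
    show ?case
    proof
      fix k
      \<comment> \<open>With the floor lowered by one, the corner lies between \<open>r k\<close>
        and \<open>2 * r k\<close> below \<open>z\<close> in each coordinate, so a side of
        \<open>3 * r k\<close> reaches at least \<open>r k\<close> beyond \<open>z\<close>.\<close>
      define m where "m i = \<lfloor>z $ i / r k\<rfloor> - 1" for i
      have m: "r k * real_of_int (m i) \<le> z $ i - r k" "z $ i - 2 * r k \<le> r k * real_of_int (m i)" for i
      proof -
        have "real_of_int (m i) \<le> z $ i / r k - 1" "z $ i / r k - 2 \<le> real_of_int (m i)"
          unfolding m_def by linarith+
        then show "r k * real_of_int (m i) \<le> z $ i - r k" "z $ i - 2 * r k \<le> r k * real_of_int (m i)"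
          using r[of k] by (simp_all add: field_simps)
      qed
      have sub: "{x. \<forall>i. \<bar>x $ i - z $ i\<bar> \<le> r k} \<subseteq> R k m"
      proof
        fix x :: "real ^ 'n" assume "x \<in> {x. \<forall>i. \<bar>x $ i - z $ i\<bar> \<le> r k}"
        then have "\<bar>x $ i - z $ i\<bar> \<le> r k" for i by simp
        then show "x \<in> R k m"
          unfolding R_def using m by (smt (verit) mem_Collect_eq)
      qed
      have "z \<in> R k m"
        using sub r[of k] by auto
      then have "(\<integral>\<^sup>+x\<in>R k m. ennreal (w x) \<partial>lebesgue)
          \<le> ennreal (A1_const w * (3 * r k) ^ CARD('n) * w z)"
        using elim by blast
      moreover have "(\<integral>\<^sup>+x\<in>{x. \<forall>i. \<bar>x $ i - z $ i\<bar> \<le> r k}. ennreal (w x) \<partial>lebesgue)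
          \<le> (\<integral>\<^sup>+x\<in>R k m. ennreal (w x) \<partial>lebesgue)"
        using sub by (intro nn_integral_mono) (auto simp: indicator_def)
      ultimately show "(\<integral>\<^sup>+x\<in>{x. \<forall>i. \<bar>x $ i - z $ i\<bar> \<le> r k}. ennreal (w x) \<partial>lebesgue)
          \<le> ennreal (A1_const w * (3 * r k) ^ CARD('n) * w z)"
        by simp
    qed
  qed
qed

section \<open>Riesz potentials of \<open>A\<^sub>1\<close> weights\<close>

text \<open>A point x \<noteq> z lies in one shell between consecutive dyadic cubes around z. There
  the Euclidean norm exceeds half of \<open>l / 2 ^ k\<close>, so the k-th term alone dominates the
  kernel. Full cubes replace the shells because the \<open>A\<^sub>1\<close> condition speaks of
  cubes.\<close>

lemma norm_powr_le_dyadic_sum: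
  fixes x z :: "real ^ 'n"
  assumes l: "0 < l" and p: "0 \<le> p" and xz: "\<forall>i. \<bar>x $ i - z $ i\<bar> \<le> l"
  shows "ennreal (norm (x - z) powr - p) \<le>
    (\<Sum>k. ennreal (2 powr p * (l / 2 ^ k) powr - p) * indicator {x. \<forall>i. \<bar>x $ i - z $ i\<bar> \<le> l / 2 ^ k} x)"
proof (cases "x = z")
  case True
  \<comment> \<open>On the diagonal the kernel has the value 0, since
    \<open>0 powr - p = 0\<close>.\<close>
  then show ?thesis by simp
next
  case False
  define P where "P j \<longleftrightarrow> (\<exists>i. l / 2 ^ j < \<bar>x $ i - z $ i\<bar>)" for j :: nat
  obtain i where i: "0 < \<bar>x $ i - z $ i\<bar>"
    using False by (auto simp: vec_eq_iff)
  have "(\<lambda>j. l * (1 / 2) ^ j) \<longlonglongrightarrow> l * 0"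
    by (intro tendsto_intros) auto
  then have "\<forall>\<^sub>F j in sequentially. l * (1 / 2) ^ j < \<bar>x $ i - z $ i\<bar>"
    using i by (intro order_tendstoD) auto
  then have ex: "\<exists>j. P j"
    unfolding P_def eventually_sequentially by (auto simp: power_one_over)
  \<comment> \<open>This is the first scale whose cube misses \<open>x\<close>. The cube of scale 0
    contains \<open>x\<close>, so \<open>j\<close> has a predecessor \<open>k\<close>, whose cube
    still contains \<open>x\<close>.\<close>
  define j where "j = (LEAST j. P j)"
  have "P j" unfolding j_def using ex by (rule LeastI_ex)
  moreover have "\<not> P 0" using xz by (auto simp: P_def not_less)
  ultimately obtain k where k: "j = Suc k" by (cases j) auto
  then have "\<not> P k" unfolding j_def by (metis lessI not_less_Least)
  then have ind: "x \<in> {x. \<forall>i. \<bar>x $ i - z $ i\<bar> \<le> l / 2 ^ k}"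
    by (auto simp: P_def not_less)
  obtain i where "l / 2 ^ Suc k < \<bar>(x - z) $ i\<bar>"
    using \<open>P j\<close> k by (auto simp: P_def)
  then have "l / 2 ^ k / 2 < norm (x - z)"
    using component_le_norm_cart[of "x - z" i] by simp
  then have "norm (x - z) powr - p \<le> (l / 2 ^ k / 2) powr - p"
    using l p by (intro powr_mono2') auto
  also have "\<dots> = 2 powr p * (l / 2 ^ k) powr - p"
    using l by (subst powr_divide) (auto simp: powr_minus field_simps)
  finally have "ennreal (norm (x - z) powr - p) \<le>
      (\<Sum>k\<in>{k}. ennreal (2 powr p * (l / 2 ^ k) powr - p) * indicator {x. \<forall>i. \<bar>x $ i - z $ i\<bar> \<le> l / 2 ^ k} x)"
    using ind by (simp add: ennreal_leI)
  also have "\<dots> \<le> (\<Sum>k. ennreal (2 powr p * (l / 2 ^ k) powr - p) *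
      indicator {x. \<forall>i. \<bar>x $ i - z $ i\<bar> \<le> l / 2 ^ k} x)"
    by (intro sum_le_suminf) auto
  finally show ?thesis .
qed

text \<open>The convex function exp lies below its chord between ln (1/2) and 0. With q =
  \<open>(1 / 2) powr e\<close> this gives 1 / (1 - q) \<le> 2 / e, the bound for the geometric
  series over the dyadic scales.\<close>

lemma half_powr_le:
  fixes e :: real
  assumes "0 \<le> e" "e \<le> 1"
  shows "(1 / 2) powr e \<le> 1 - e / 2"
proof -
  have "exp ((1 - e) *\<^sub>R 0 + e *\<^sub>R ln (1 / 2)) \<le> (1 - e) * exp 0 + e * exp (ln (1 / 2 :: real))"
    using assms by (intro convex_onD[OF exp_convex]) auto
  then show ?thesis
    by (simp add: powr_def mult_ac)
qed

text \<open>At scale s = \<open>l / 2 ^ k\<close> the kernel is of size s to the power -(n - e), and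
  the weight of the cube is at most of order s to the power n times \<open>w z\<close>. The product
  decays like s to the power e, a geometric series in k.\<close>

lemma A1_potential_le:
  fixes w :: "real ^ 'n \<Rightarrow> real" and e :: real
  assumes w: "A1_weight w" and l: "0 < l" and e: "0 < e" "e < 1"
  shows "AE z in lebesgue.
    (\<integral>\<^sup>+x\<in>{x. \<forall>i. \<bar>x $ i - z $ i\<bar> \<le> l}.
        ennreal (norm (x - z) powr - (CARD('n) - e)) * ennreal (w x) \<partial>lebesgue)
      \<le> ennreal (2 * 6 ^ CARD('n) * A1_const w * (l powr e / e)) * ennreal (w z)"
proof -
  define n where "n = CARD('n)"
  define p where "p = real n - e"
  define q where "q = (1 / 2 :: real) powr e"
  define A where "A = A1_const w"
  have A: "0 \<le> A" using A1_const_nonneg[OF w] by (simp add: A_def)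
  have "1 \<le> real n" by (simp add: n_def Suc_leI)
  then have p: "0 \<le> p" "p \<le> n" using e by (auto simp: p_def)
  have q: "0 < q" "q < 1" "1 / (1 - q) \<le> 2 / e"
    using half_powr_le[of e] e by (auto simp: q_def field_simps)
  have [measurable]: "w \<in> borel_measurable lebesgue"
    using w by (auto simp: A1_weight_def weight_def intro: locally_integrable_measurable)
  have pos: "AE x in lebesgue. 0 < w x"
    using w by (auto simp: A1_weight_def weight_def)
  have "AE z in lebesgue. \<forall>k.
    (\<integral>\<^sup>+x\<in>{x. \<forall>i. \<bar>x $ i - z $ i\<bar> \<le> l / 2 ^ k}. ennreal (w x) \<partial>lebesgue)
      \<le> ennreal (A * (3 * (l / 2 ^ k)) ^ n * w z)"
    using A1_centred_cubes_integral_le[OF w, of "\<lambda>k. l / 2 ^ k"] l by (simp add: A_def n_def)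
  then show ?thesis
    using pos
  proof eventually_elim
    case (elim z)
    define B where "B k = {x :: real ^ 'n. \<forall>i. \<bar>x $ i - z $ i\<bar> \<le> l / 2 ^ k}" for k :: nat
    define c where "c k = 2 powr p * (l / 2 ^ k) powr - p" for k :: nat
    have [measurable]: "B k \<in> sets lebesgue" for k
    proof -
      have "B k = cbox (\<chi> i. z $ i - l / 2 ^ k) (\<chi> i. z $ i + l / 2 ^ k)"
        by (auto simp: B_def mem_box_cart abs_le_iff algebra_simps)
      then show ?thesis by simp
    qed
    have "(\<integral>\<^sup>+x\<in>{x. \<forall>i. \<bar>x $ i - z $ i\<bar> \<le> l}.
        ennreal (norm (x - z) powr - p) * ennreal (w x) \<partial>lebesgue)
      \<le> (\<integral>\<^sup>+x. (\<Sum>k. ennreal (c k) * (ennreal (w x) * indicator (B k) x)) \<partial>lebesgue)"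
    proof (rule nn_integral_mono)
      fix x :: "real ^ 'n"
      show "ennreal (norm (x - z) powr - p) * ennreal (w x) * indicator {x. \<forall>i. \<bar>x $ i - z $ i\<bar> \<le> l} x
          \<le> (\<Sum>k. ennreal (c k) * (ennreal (w x) * indicator (B k) x))"
      proof (cases "\<forall>i. \<bar>x $ i - z $ i\<bar> \<le> l")
        case True
        have "ennreal (norm (x - z) powr - p) * ennreal (w x)
            \<le> (\<Sum>k. ennreal (c k) * indicator (B k) x) * ennreal (w x)"
          using norm_powr_le_dyadic_sum[OF l p(1) True]
          by (intro mult_right_mono) (auto simp: c_def B_def)
        also have "\<dots> = (\<Sum>k. ennreal (c k) * (ennreal (w x) * indicator (B k) x))"
          by (simp add: mult_ac flip: ennreal_suminf_cmult)
        finally show ?thesis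
          using True by simp
      qed simp
    qed
    also have "\<dots> = (\<Sum>k. \<integral>\<^sup>+x. ennreal (c k) * (ennreal (w x) * indicator (B k) x) \<partial>lebesgue)"
      by (intro nn_integral_suminf) measurable
    also have "\<dots> = (\<Sum>k. ennreal (c k) * (\<integral>\<^sup>+x\<in>B k. ennreal (w x) \<partial>lebesgue))"
      by (intro suminf_cong nn_integral_cmult) measurable
    also have "\<dots> \<le> (\<Sum>k. ennreal (c k) * ennreal (A * (3 * (l / 2 ^ k)) ^ n * w z))"
      using elim(1) unfolding B_def by (intro suminf_le mult_left_mono) auto
    also have "\<dots> = (\<Sum>k. ennreal (2 powr p * 3 ^ n * A * w z * l powr e * q ^ k))"
    proof (intro suminf_cong)
      fix k
      define s where "s = l / 2 ^ k"
      have s: "0 < s" using l by (simp add: s_def)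
      have "s powr - p * s ^ n = s powr e"
        using s by (simp add: p_def powr_realpow[symmetric] powr_add[symmetric])
      moreover have "s powr e = l powr e * q ^ k"
      proof -
        have "s = l * (1 / 2) powr real k"
          by (simp add: s_def powr_realpow power_one_over)
        then show ?thesis
          using l by (simp add: powr_mult powr_powr q_def powr_realpow[symmetric] mult.commute)
      qed
      ultimately have "c k * (A * (3 * s) ^ n * w z) = 2 powr p * 3 ^ n * A * w z * l powr e * q ^ k"
        by (simp add: c_def s_def[symmetric] power_mult_distrib mult_ac)
      then show "ennreal (c k) * ennreal (A * (3 * (l / 2 ^ k)) ^ n * w z) =
          ennreal (2 powr p * 3 ^ n * A * w z * l powr e * q ^ k)"
        by (subst ennreal_mult'[symmetric]) (simp_all only: s_def, simp add: c_def)
    qed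
    also have "\<dots> = ennreal (2 powr p * 3 ^ n * A * w z * l powr e * (1 / (1 - q)))"
      using q A elim(2) by (intro suminf_ennreal_eq sums_mult geometric_sums) auto
    \<comment> \<open>The 2 ^ n comes from the shells and the 3 ^ n from enlarging cubes to the
      lattice, together 6 ^ n; the factor 2 / e bounds the geometric series.\<close>
    also have "\<dots> \<le> ennreal (2 ^ n * 3 ^ n * A * w z * l powr e * (2 / e))"
    proof (intro ennreal_leI mult_mono mult_nonneg_nonneg)
      show "2 powr p \<le> 2 ^ n"
        using p powr_mono[of p "real n" 2] by (simp add: powr_realpow)
    qed (use q A elim(2) in auto)
    also have "2 ^ n * 3 ^ n * A * w z * l powr e * (2 / e) = 2 * 6 ^ n * A * (l powr e / e) * w z"
      by (simp flip: power_mult_distrib)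
    also have "ennreal \<dots> = ennreal (2 * 6 ^ n * A * (l powr e / e)) * ennreal (w z)"
      using A e elim(2) by (intro ennreal_mult) auto
    finally show ?case
      by (simp add: p_def n_def A_def)
  qed
qed

section \<open>Fractional differences bounded by Riesz potentials\<close>

text \<open>Passing to the larger exponent b costs \<open>norm (x - y) powr (b - a)\<close>. The
  norm is at most \<open>CARD('n) * l\<close> by comparison with the sum of the components, and b -
  a \<le> 1 keeps the dimensional factor below \<open>CARD('n)\<close>.\<close>

lemma norm_powr_le_of_components:
  fixes x y :: "real ^ 'n"
  assumes xy: "\<And>i. \<bar>x $ i - y $ i\<bar> \<le> l" "x \<noteq> y" and ab: "0 \<le> b - a" "b - a \<le> 1"
  shows "norm (x - y) powr - a \<le> CARD('n) * l powr (b - a) * norm (x - y) powr - b"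
proof -
  have "norm (x - y) \<le> (\<Sum>i\<in>UNIV. \<bar>(x - y) $ i\<bar>)"
    by (rule norm_le_l1_cart)
  also have "\<dots> \<le> (\<Sum>i\<in>(UNIV :: 'n set). l)"
    using xy by (intro sum_mono) auto
  finally have le: "norm (x - y) \<le> CARD('n) * l" by simp
  then have "0 < CARD('n) * l"
    using xy(2) by (meson less_le_trans right_minus_eq zero_less_norm_iff)
  then have l: "0 < l"
    by (simp add: zero_less_mult_iff)
  have "norm (x - y) powr - a = norm (x - y) powr (b - a) * norm (x - y) powr - b"
    by (simp flip: powr_add)
  also have "norm (x - y) powr (b - a) \<le> (CARD('n) * l) powr (b - a)"
    using le ab by (intro powr_mono2) auto
  also have "\<dots> = real CARD('n) powr (b - a) * l powr (b - a)"
    using l by (simp add: powr_mult)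
  also have "real CARD('n) powr (b - a) \<le> real CARD('n) powr 1"
    using ab by (intro powr_mono) (auto simp: Suc_leI)
  finally show ?thesis
    by (simp add: mult_right_mono)
qed

text \<open>The exponent is first raised from a to b. The segment estimate, Tonelli in y and t, and
  dilation for each fixed t then produce t to the power b - 1, whose integral is 1 / b.\<close>

lemma C1_on_fractional_difference_le_potential:
  fixes u :: "real ^ 'n \<Rightarrow> real"
  assumes Q: "cube l Q" and u: "C1_on Q u" and x: "x \<in> Q" and ab: "0 \<le> a" "a \<le> b" "0 < b" "b \<le> 1"
  defines "n \<equiv> real CARD('n)"
  shows "(\<integral>\<^sup>+y\<in>Q. ennreal (\<bar>u x - u y\<bar> / norm (x - y) powr (n + a)) \<partial>lebesgue)
    \<le> ennreal (n * l powr (b - a) / b) *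
      (\<integral>\<^sup>+z\<in>Q. ennreal (norm (grad Q u z)) * ennreal (norm (x - z) powr - (n - (1 - b))) \<partial>lborel)"
proof -
  \<comment> \<open>The length of the segment cancels one power of the kernel exponent n +
    b.\<close>
  define p where "p = n - (1 - b)"
  define K where "K = n * l powr (b - a)"
  have K: "0 \<le> K" by (simp add: K_def n_def)
  define g where "g z = ennreal (norm (grad Q u z)) * indicator Q z" for z
  have g [measurable]: "g \<in> borel_measurable borel"
    unfolding g_def by (rule C1_on_norm_grad_measurable[OF cube_sets_borel[OF Q] u])
  define h where "h y t = g (x + t *\<^sub>R (y - x)) * ennreal (norm (x - y) powr - p) * indicator {0..1} t"
    for y and t :: real
  have [measurable]: "(\<lambda>(y, t). h y t) \<in> borel_measurable (lborel \<Otimes>\<^sub>M lborel)"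
    unfolding h_def by measurable
  have [measurable]: "(\<lambda>t. h y t) \<in> borel_measurable borel" for y
    unfolding h_def by measurable
  have pointwise: "ennreal (\<bar>u x - u y\<bar> / norm (x - y) powr (n + a))
      \<le> ennreal K * (\<integral>\<^sup>+t. h y t \<partial>lborel)" if y: "y \<in> Q" for y
  proof (cases "x = y")
    case False
    define r where "r = norm (x - y)"
    have r: "0 < r" using False by (simp add: r_def)
    have seg: "x + t *\<^sub>R (y - x) \<in> Q" if "t \<in> {0..1}" for t
    proof -
      have "x + t *\<^sub>R (y - x) = (1 - t) *\<^sub>R x + t *\<^sub>R y" by (simp add: algebra_simps)
      then show ?thesis
        using cube_convex[OF Q] x y that by (auto simp: convex_alt)
    qed
    have "r powr - (n + a) \<le> K * r powr - (n + b)"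
      using norm_powr_le_of_components[of x y l "n + b" "n + a"] cube_component_diff_le[OF Q x y] False ab
      by (simp add: r_def K_def n_def)
    then have "r powr - (n + a) * \<bar>u x - u y\<bar> \<le> K * r powr - (n + b) * \<bar>u x - u y\<bar>"
      by (rule mult_right_mono) simp
    then have "\<bar>u x - u y\<bar> / r powr (n + a) \<le> K * r powr - (n + b) * \<bar>u x - u y\<bar>"
      unfolding powr_minus[of r "n + a"] by (simp add: divide_inverse mult.commute)
    then have "ennreal (\<bar>u x - u y\<bar> / r powr (n + a)) \<le> ennreal (K * r powr - (n + b)) * ennreal \<bar>u x - u y\<bar>"
      using K by (simp add: ennreal_mult'[symmetric] ennreal_leI)
    also have "\<dots> \<le> ennreal (K * r powr - (n + b)) * (ennreal r *
        (\<integral>\<^sup>+t\<in>{0..1}. ennreal (norm (grad Q u (x + t *\<^sub>R (y - x)))) \<partial>lborel))"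
      unfolding r_def
      by (intro mult_left_mono C1_on_diff_le_segment_integral[OF cube_convex[OF Q] u x y]) simp
    also have "(\<integral>\<^sup>+t\<in>{0..1}. ennreal (norm (grad Q u (x + t *\<^sub>R (y - x)))) \<partial>lborel) =
        (\<integral>\<^sup>+t\<in>{0..1}. g (x + t *\<^sub>R (y - x)) \<partial>lborel)"
      using seg by (intro nn_integral_cong) (auto simp: g_def indicator_def)
    also have "ennreal (K * r powr - (n + b)) * (ennreal r * (\<integral>\<^sup>+t\<in>{0..1}. g (x + t *\<^sub>R (y - x)) \<partial>lborel)) =
        ennreal K * (ennreal (r powr - p) * (\<integral>\<^sup>+t\<in>{0..1}. g (x + t *\<^sub>R (y - x)) \<partial>lborel))"
    proof -
      have "r powr - (n + b) * r = r powr - p"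
        using r powr_add[of r "- (n + b)" 1] by (simp add: p_def algebra_simps)
      then have "ennreal (K * r powr - (n + b)) * ennreal r = ennreal K * ennreal (r powr - p)"
        using K r by (simp add: ennreal_mult'[symmetric] mult.assoc)
      then show ?thesis
        by (simp only: mult.assoc[symmetric])
    qed
    also have "ennreal (r powr - p) * (\<integral>\<^sup>+t\<in>{0..1}. g (x + t *\<^sub>R (y - x)) \<partial>lborel) = (\<integral>\<^sup>+t. h y t \<partial>lborel)"
      unfolding h_def r_def by (subst nn_integral_cmult[symmetric]) (auto simp: mult_ac)
    finally show ?thesis by (simp add: r_def)
  qed simp
  \<comment> \<open>The outer integral is enlarged to all \<open>y\<close>, as the dilation acts on
    the whole space; the cut-off to \<open>Q\<close> survives inside \<open>g\<close>, at the point
    of the segment.\<close>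
  have "(\<integral>\<^sup>+y\<in>Q. ennreal (\<bar>u x - u y\<bar> / norm (x - y) powr (n + a)) \<partial>lebesgue)
      \<le> (\<integral>\<^sup>+y. ennreal K * (\<integral>\<^sup>+t. h y t \<partial>lborel) \<partial>lebesgue)"
    using pointwise by (intro nn_integral_mono) (auto simp: indicator_def)
  also have "\<dots> = ennreal K * (\<integral>\<^sup>+y. (\<integral>\<^sup>+t. h y t \<partial>lborel) \<partial>lborel)"
    unfolding nn_integral_completion by (intro nn_integral_cmult) measurable
  also have "(\<integral>\<^sup>+y. (\<integral>\<^sup>+t. h y t \<partial>lborel) \<partial>lborel) = (\<integral>\<^sup>+t. (\<integral>\<^sup>+y. h y t \<partial>lborel) \<partial>lborel)"
    by (rule lborel_pair.Fubini'[symmetric]) measurable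
  also have "\<dots> = (\<integral>\<^sup>+t. (ennreal (t powr (b - 1)) * indicator {0..1} t) *
      (\<integral>\<^sup>+z. g z * ennreal (norm (x - z) powr - p) \<partial>lborel) \<partial>lborel)"
  proof (rule nn_integral_cong_AE)
    \<comment> \<open>The dilation degenerates at t = 0, a null set.\<close>
    have "AE t in lborel. (t :: real) \<noteq> 0"
      by (rule AE_lborel_singleton)
    then show "AE t in lborel. (\<integral>\<^sup>+y. h y t \<partial>lborel) = (ennreal (t powr (b - 1)) * indicator {0..1} t) *
      (\<integral>\<^sup>+z. g z * ennreal (norm (x - z) powr - p) \<partial>lborel)"
    proof eventually_elim
      case (elim t)
      show ?case
      proof (cases "t \<in> {0..1}")
        case True
        then have "0 < t" using elim by simp
        from nn_integral_lborel_dilation[OF g this, of x p] True show ?thesis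
          by (simp add: h_def p_def n_def)
      qed (simp add: h_def)
    qed
  qed
  also have "\<dots> = ennreal (1 / b) * (\<integral>\<^sup>+z. g z * ennreal (norm (x - z) powr - p) \<partial>lborel)"
    using nn_integral_powr_unit_interval[of "b - 1"] ab by (subst nn_integral_multc) auto
  also have "(\<integral>\<^sup>+z. g z * ennreal (norm (x - z) powr - p) \<partial>lborel) =
      (\<integral>\<^sup>+z\<in>Q. ennreal (norm (grad Q u z)) * ennreal (norm (x - z) powr - p) \<partial>lborel)"
    by (intro nn_integral_cong) (simp add: g_def mult_ac)
  also have "ennreal K * (ennreal (1 / b) * \<dots>) = ennreal (K / b) * \<dots>"
    using K ab by (simp add: mult.assoc[symmetric] ennreal_mult'[symmetric])
  finally show ?thesis
    by (simp add: K_def p_def)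
qed

section \<open>Moving the potential from the function to the weight\<close>

text \<open>The kernel is symmetric and everything is nonnegative, so Tonelli lets the potential act
  on \<open>w\<close> instead of \<open>G\<close>, where \<open>A1_potential_le\<close> bounds it
  pointwise by \<open>w\<close>.\<close>

lemma A1_weighted_potential_le:
  fixes w :: "real ^ 'n \<Rightarrow> real" and e :: real
  assumes w: "A1_weight w" and Q: "cube l Q" and e: "0 < e" "e < 1"
    and G [measurable]: "G \<in> borel_measurable borel"
  shows "(\<integral>\<^sup>+x\<in>Q. (\<integral>\<^sup>+z. G z * indicator Q z * ennreal (norm (x - z) powr - (CARD('n) - e)) \<partial>lborel)
        * ennreal (w x) \<partial>lebesgue)
    \<le> ennreal (2 * 6 ^ CARD('n) * A1_const w * (l powr e / e)) * (\<integral>\<^sup>+z\<in>Q. G z * ennreal (w z) \<partial>lebesgue)"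
proof -
  define p where "p = CARD('n) - e"
  define P where "P = ennreal (2 * 6 ^ CARD('n) * A1_const w * (l powr e / e))"
  have [measurable]: "Q \<in> sets borel" using cube_sets_borel[OF Q] .
  have l: "0 < l" using Q by (simp add: cube_def)
  have [measurable]: "w \<in> borel_measurable lebesgue"
    using w by (auto simp: A1_weight_def weight_def intro: locally_integrable_measurable)
  \<comment> \<open>Tonelli is used for \<open>lborel\<close>, while \<open>w\<close> is only
    Lebesgue measurable; it is replaced by a Borel function \<open>W\<close> equal to it almost
    everywhere, and restored afterwards.\<close>
  have "(\<lambda>x. ennreal (w x)) \<in> borel_measurable lebesgue" by measurable
  from completion_ex_borel_measurable[OF this]
  obtain W where [measurable]: "W \<in> borel_measurable borel" and W: "AE x in lborel. ennreal (w x) = W x"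
    by auto
  have W': "AE x in lebesgue. ennreal (w x) = W x"
    using W by (rule AE_completion)
  define k where "k x z = ennreal (norm (x - z) powr - p)" for x z :: "real ^ 'n"
  have [measurable]: "(\<lambda>x. k (f x) (h x)) \<in> borel_measurable M"
    if [measurable]: "f \<in> borel_measurable M" "h \<in> borel_measurable M" for f h and M :: "'z measure"
    unfolding k_def by measurable
  have k_commute: "k x z = k z x" for x z
    by (simp add: k_def norm_minus_commute)
  have "(\<integral>\<^sup>+x\<in>Q. (\<integral>\<^sup>+z. G z * indicator Q z * k x z \<partial>lborel) * ennreal (w x) \<partial>lebesgue) =
      (\<integral>\<^sup>+x. (\<integral>\<^sup>+z. G z * indicator Q z * k x z \<partial>lborel) * W x * indicator Q x \<partial>lebesgue)"
    using W' by (intro nn_integral_cong_AE) (auto elim: eventually_mono)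
  also have "\<dots> = (\<integral>\<^sup>+x. (\<integral>\<^sup>+z. G z * indicator Q z * k x z * W x * indicator Q x \<partial>lborel) \<partial>lborel)"
    unfolding nn_integral_completion by (simp add: nn_integral_multc)
  also have "\<dots> = (\<integral>\<^sup>+z. (\<integral>\<^sup>+x. G z * indicator Q z * k x z * W x * indicator Q x \<partial>lborel) \<partial>lborel)"
    by (rule lborel_pair.Fubini') measurable
  also have "\<dots> = (\<integral>\<^sup>+z. G z * indicator Q z * (\<integral>\<^sup>+x. k x z * W x * indicator Q x \<partial>lborel) \<partial>lborel)"
    by (simp add: nn_integral_cmult[symmetric] mult_ac)
  also have "\<dots> = (\<integral>\<^sup>+z. G z * indicator Q z * (\<integral>\<^sup>+x. k x z * W x * indicator Q x \<partial>lebesgue) \<partial>lebesgue)"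
    by (simp add: nn_integral_completion)
  also have "\<dots> = (\<integral>\<^sup>+z. G z * indicator Q z * (\<integral>\<^sup>+x\<in>Q. k x z * ennreal (w x) \<partial>lebesgue) \<partial>lebesgue)"
    using W' by (intro nn_integral_cong arg_cong2[where f = "(*)"] refl nn_integral_cong_AE)
      (auto elim: eventually_mono)
  also have "\<dots> \<le> (\<integral>\<^sup>+z. P * (G z * ennreal (w z) * indicator Q z) \<partial>lebesgue)"
  proof (rule nn_integral_mono_AE)
    have "AE z in lebesgue. (\<integral>\<^sup>+x\<in>{x. \<forall>i. \<bar>x $ i - z $ i\<bar> \<le> l}. k x z * ennreal (w x) \<partial>lebesgue)
        \<le> P * ennreal (w z)"
      using A1_potential_le[OF w l e] by (simp add: k_def p_def P_def)
    then show "AE z in lebesgue. G z * indicator Q z * (\<integral>\<^sup>+x\<in>Q. k x z * ennreal (w x) \<partial>lebesgue)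
        \<le> P * (G z * ennreal (w z) * indicator Q z)"
    proof eventually_elim
      case (elim z)
      show ?case
      proof (cases "z \<in> Q")
        case True
        \<comment> \<open>For \<open>z\<close> in \<open>Q\<close>, the cube centred at
          \<open>z\<close> with half-side \<open>l\<close> contains \<open>Q\<close>.\<close>
        have "(\<integral>\<^sup>+x\<in>Q. k x z * ennreal (w x) \<partial>lebesgue)
            \<le> (\<integral>\<^sup>+x\<in>{x. \<forall>i. \<bar>x $ i - z $ i\<bar> \<le> l}. k x z * ennreal (w x) \<partial>lebesgue)"
          using cube_component_diff_le[OF Q _ True] by (intro nn_integral_mono) (auto simp: indicator_def)
        also note elim
        finally have "G z * (\<integral>\<^sup>+x\<in>Q. k x z * ennreal (w x) \<partial>lebesgue) \<le> G z * (P * ennreal (w z))"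
          by (rule mult_left_mono) simp
        then show ?thesis using True by (simp add: mult_ac)
      qed simp
    qed
  qed
  also have "\<dots> = P * (\<integral>\<^sup>+z\<in>Q. G z * ennreal (w z) \<partial>lebesgue)"
  proof (rule nn_integral_cmult)
    have "G \<in> borel_measurable lebesgue" "indicator Q \<in> borel_measurable lebesgue"
      by (rule measurable_completion, measurable)+
    then show "(\<lambda>z. G z * ennreal (w z) * indicator Q z) \<in> borel_measurable lebesgue"
      by measurable
  qed
  finally show ?thesis
    by (simp add: k_def p_def P_def)
qed

section \<open>Choice of the intermediate exponent and of the constant\<close>

theorem theorem2p2:
  assumes "2 \<le> CARD('n::finite)"
  shows "\<exists>C>0. \<forall>\<delta> (w :: real ^ 'n \<Rightarrow> real) l Q u.
    0 < \<delta> \<and> \<delta> < 1 \<and> A1_weight w \<and> cube l Q \<and> C1_on Q u \<longrightarrow>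
      ennreal (l powr \<delta>) *
        (\<integral>\<^sup>+x\<in>Q. (\<integral>\<^sup>+y\<in>Q. ennreal (\<bar>u x - u y\<bar> / norm (x - y) powr (real CARD('n) + \<delta>)) \<partial>lebesgue)
          * ennreal (w x) \<partial>lebesgue)
      \<le> ennreal (C * (A1_const w / (1 - \<delta>)\<^sup>2) * l) *
        (\<integral>\<^sup>+x\<in>Q. ennreal (norm (grad Q u x) * w x) \<partial>lebesgue)"
proof -
  define n where "n = real CARD('n)"
  \<comment> \<open>The potential bound gives \<open>2 * 6 ^ CARD('n)\<close>, the change of
    exponent gives \<open>n\<close>, and the estimate of \<open>1 / (b * (1 - b))\<close> gives
    4.\<close>
  define C where "C = 8 * n * 6 ^ CARD('n)"
  have n: "0 < n" by (simp add: n_def)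
  then have "0 < C" by (simp add: C_def)
  moreover have "ennreal (l powr \<delta>) *
        (\<integral>\<^sup>+x\<in>Q. (\<integral>\<^sup>+y\<in>Q. ennreal (\<bar>u x - u y\<bar> / norm (x - y) powr (n + \<delta>)) \<partial>lebesgue)
          * ennreal (w x) \<partial>lebesgue)
      \<le> ennreal (C * (A1_const w / (1 - \<delta>)\<^sup>2) * l) *
        (\<integral>\<^sup>+x\<in>Q. ennreal (norm (grad Q u x) * w x) \<partial>lebesgue)"
    if \<delta>: "0 < \<delta>" "\<delta> < 1" and w: "A1_weight w" and Q: "cube l Q" and u: "C1_on Q u"
    for \<delta> and w :: "real ^ 'n \<Rightarrow> real" and l Q u
  proof -
    \<comment> \<open>The midpoint of \<delta> and 1 satisfies b \<ge> 1/2, which keeps 1 / b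
      bounded, while 1 - b is still half of 1 - \<delta>.\<close>
    define b where "b = (1 + \<delta>) / 2"
    have b: "0 \<le> \<delta>" "\<delta> \<le> b" "0 < b" "b \<le> 1" "1 / 2 \<le> b" "0 < 1 - b" "1 - b < 1" "1 - b = (1 - \<delta>) / 2"
      using \<delta> by (auto simp: b_def field_simps)
    have l: "0 < l" using Q by (simp add: cube_def)
    have A: "0 \<le> A1_const w" using A1_const_nonneg[OF w] .
    \<comment> \<open>The cut-off makes \<open>G\<close> Borel on the whole space; repeating the
      indicator in \<open>V\<close> changes nothing.\<close>
    define G where "G z = ennreal (norm (grad Q u z)) * indicator Q z" for z
    define I where "I = (\<integral>\<^sup>+x\<in>Q. ennreal (norm (grad Q u x) * w x) \<partial>lebesgue)"
    define K where "K = n * l powr (b - \<delta>) / b"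
    define P where "P = 2 * 6 ^ CARD('n) * A1_const w * (l powr (1 - b) / (1 - b))"
    have K: "0 \<le> K" using n b by (simp add: K_def)
    have P: "0 \<le> P" using A b by (simp add: P_def)
    define V where "V x = (\<integral>\<^sup>+z. G z * indicator Q z * ennreal (norm (x - z) powr - (CARD('n) - (1 - b))) \<partial>lborel)"
      for x
    have [measurable]: "G \<in> borel_measurable borel"
      unfolding G_def by (rule C1_on_norm_grad_measurable[OF cube_sets_borel[OF Q] u])
    have [measurable]: "Q \<in> sets borel" using cube_sets_borel[OF Q] .
    have [measurable]: "w \<in> borel_measurable lebesgue"
      using w by (auto simp: A1_weight_def weight_def intro: locally_integrable_measurable)
    have V: "(\<integral>\<^sup>+y\<in>Q. ennreal (\<bar>u x - u y\<bar> / norm (x - y) powr (n + \<delta>)) \<partial>lebesgue) \<le> ennreal K * V x"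
      if "x \<in> Q" for x
    proof -
      have "V x = (\<integral>\<^sup>+z\<in>Q. ennreal (norm (grad Q u z)) * ennreal (norm (x - z) powr - (n - (1 - b))) \<partial>lborel)"
        unfolding V_def n_def by (intro nn_integral_cong) (auto simp: G_def indicator_def)
      then show ?thesis
        using C1_on_fractional_difference_le_potential[OF Q u that b(1-4)] by (simp add: K_def n_def)
    qed
    have "(\<integral>\<^sup>+x\<in>Q. (\<integral>\<^sup>+y\<in>Q. ennreal (\<bar>u x - u y\<bar> / norm (x - y) powr (n + \<delta>)) \<partial>lebesgue)
          * ennreal (w x) \<partial>lebesgue)
        \<le> (\<integral>\<^sup>+x. ennreal K * (V x * ennreal (w x) * indicator Q x) \<partial>lebesgue)"
    proof (rule nn_integral_mono)
      fix x
      show "(\<integral>\<^sup>+y\<in>Q. ennreal (\<bar>u x - u y\<bar> / norm (x - y) powr (n + \<delta>)) \<partial>lebesgue) * ennreal (w x) * indicator Q x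
          \<le> ennreal K * (V x * ennreal (w x) * indicator Q x)"
        using mult_right_mono[OF V, of x "ennreal (w x)"] by (cases "x \<in> Q") (auto simp: mult_ac)
    qed
    also have "\<dots> = ennreal K * (\<integral>\<^sup>+x\<in>Q. V x * ennreal (w x) \<partial>lebesgue)"
    proof (rule nn_integral_cmult)
      have "V \<in> borel_measurable lborel"
        unfolding V_def by measurable
      then have "V \<in> borel_measurable lebesgue"
        by (rule measurable_completion)
      moreover have "indicator Q \<in> borel_measurable lebesgue"
        by (rule measurable_completion) measurable
      ultimately show "(\<lambda>x. V x * ennreal (w x) * indicator Q x) \<in> borel_measurable lebesgue"
        by measurable
    qed
    also have "\<dots> \<le> ennreal K * (ennreal P * (\<integral>\<^sup>+z\<in>Q. G z * ennreal (w z) \<partial>lebesgue))"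
      unfolding V_def P_def
      by (intro mult_left_mono A1_weighted_potential_le[OF w Q b(6,7)]) simp_all
    also have "(\<integral>\<^sup>+z\<in>Q. G z * ennreal (w z) \<partial>lebesgue) = I"
      unfolding I_def by (intro nn_integral_cong) (auto simp: G_def ennreal_mult' indicator_def)
    finally have "ennreal (l powr \<delta>) *
        (\<integral>\<^sup>+x\<in>Q. (\<integral>\<^sup>+y\<in>Q. ennreal (\<bar>u x - u y\<bar> / norm (x - y) powr (n + \<delta>)) \<partial>lebesgue)
          * ennreal (w x) \<partial>lebesgue) \<le> ennreal (l powr \<delta>) * (ennreal K * (ennreal P * I))"
      by (rule mult_left_mono) simp
    also have "\<dots> = ennreal (l powr \<delta> * K * P) * I"
      using K P by (simp add: ennreal_mult mult.assoc)
    also have "\<dots> \<le> ennreal (C * (A1_const w / (1 - \<delta>)\<^sup>2) * l) * I"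
    proof (intro mult_right_mono ennreal_leI)
      \<comment> \<open>The three powers come from the left-hand side, the change of exponent and
        the potential; their exponents add up to 1.\<close>
      have "l powr \<delta> * l powr (b - \<delta>) * l powr (1 - b) = l"
        using l by (simp flip: powr_add)
      then have "l powr \<delta> * K * P = (2 * n * 6 ^ CARD('n) * A1_const w * l) * (1 / (b * (1 - b)))"
        unfolding K_def P_def by (simp add: field_simps)
      also have "\<dots> \<le> (2 * n * 6 ^ CARD('n) * A1_const w * l) * (4 / (1 - \<delta>)\<^sup>2)"
      proof (intro mult_left_mono)
        \<comment> \<open>Since b \<ge> 1/2, \<open>1 / (b * (1 - b))\<close> is at most 4 / (1 -
          \<delta>); this is weakened to the square in the denominator.\<close>
        have "(1 - \<delta>)\<^sup>2 \<le> 1 - \<delta>"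
          using \<delta> by (simp add: power2_eq_square mult_left_le)
        moreover have "1 - b \<le> 2 * (b * (1 - b))"
          using b(5,6) mult_right_mono[of 1 "2 * b" "1 - b"] by simp
        moreover have "1 - \<delta> = 2 * (1 - b)"
          using b(8) by simp
        ultimately have "(1 - \<delta>)\<^sup>2 \<le> 2 * (2 * (b * (1 - b)))"
          by (metis mult_le_cancel_left_pos order_trans zero_less_numeral)
        then have "(1 - \<delta>)\<^sup>2 \<le> 4 * (b * (1 - b))"
          by simp
        then show "1 / (b * (1 - b)) \<le> 4 / (1 - \<delta>)\<^sup>2"
          using b(3,6) \<delta> by (simp add: divide_simps)
      qed (use n A l in auto)
      also have "\<dots> = C * (A1_const w / (1 - \<delta>)\<^sup>2) * l"
        by (simp add: C_def)
      finally show "l powr \<delta> * K * P \<le> C * (A1_const w / (1 - \<delta>)\<^sup>2) * l" .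
    qed simp
    finally show ?thesis
      by (simp add: I_def)
  qed
  ultimately show ?thesis
    unfolding n_def by blast
qed

end
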